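(* Let $G$ be a connected simple graph with $n$ vertices and let $T=T(v_0,v_1,\dots,v_s)$ be a greedy spanning tree of $G$. Let $n_1$ be the length of the orbit of $v_0$ under the action of the automorphism group of $G$. Then $$\mathrm{aut}(G)\leq n_1\,(d(v_0))!\prod_{i=1}^s (d_T(v_i)-1)!.$$ In particular, for any greedy spanning tree $T=T(v_0,v_1,\dots,v_s)$ of $G$, $$\mathrm{aut}(G)\leq n\,(d(v_0))!\prod_{v\in V(G)}(d_T(v)-1)!.$$
   Context: $\mathrm{aut}(G)$ is the order of the automorphism group of $G$; $d(v)$ is the degree of $v$ in $G$ and $d_T(v)$ the degree of $v$ in the tree $T$. A greedy spanning tree $T(v_0,v_1,\dots,v_s)$ of a connected graph $G$ is constructed as follows. Choose any vertex $v_0$ and let $T_0$ be the star consisting of $v_0$, all its neighbours, and all edges of $G$ incident to $v_0$. Given the tree $T_{i-1}$, choose a leaf $v_i$ of $T_{i-1}$ that has at least one incident edge $v_iw$ in $G$ with $w\notin V(T_{i-1})$, and let $T_i$ be obtained from $T_{i-1}$ by adding all edges $v_iw$ of $G$ with $w\notin V(T_{i-1})$ (together with these vertices $w$). The construction stops at step $s$ when no leaf $v$ of $T_s$ has an incident edge of $G$ whose other endpoint lies outside $V(T_s)$; the resulting tree $T=T_s$ is a spanning tree of $G$, called a greedy spanning tree and denoted $T(v_0,v_1,\dots,v_s)$. *)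

theory Defs
  imports
    "Graph_Theory.Digraph_Component"
    "HOL-Algebra.Bij"
    "HOL-Algebra.Group_Action"
begin

text \<open>
  Finite simple graphs are modelled by \<^locale>\<open>pair_graph\<close>: an undirected edge \<open>uv\<close> is
  the pair of arcs \<open>(u, v)\<close> and \<open>(v, u)\<close>, and so the degree of a vertex is its
  \<^const>\<open>out_degree\<close>. Trees are represented in the same way; note that the library's
  \<^const>\<open>tree\<close> counts \<open>u, v, u\<close> as a cycle and so does not apply to symmetric digraphs.
\<close>

text \<open>Extensionality in \<^const>\<open>Bij\<close> makes an automorphism determined by its values on the vertices.\<close>

definition graph_automorphisms :: "'a pair_pre_digraph \<Rightarrow> ('a \<Rightarrow> 'a) set" where
  "graph_automorphisms G =
     {f \<in> Bij (pverts G). \<forall>x \<in> pverts G. \<forall>y \<in> pverts G. (f x, f y) \<in> parcs G \<longleftrightarrow> (x, y) \<in> parcs G}"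

definition automorphism_group :: "'a pair_pre_digraph \<Rightarrow> ('a \<Rightarrow> 'a) monoid" where
  "automorphism_group G = BijGroup (pverts G) \<lparr>carrier := graph_automorphisms G\<rparr>"

lemma subgroup_graph_automorphisms:
  "subgroup (graph_automorphisms G) (BijGroup (pverts G))"
proof (rule group.subgroupI[OF group_BijGroup])
  show "graph_automorphisms G \<subseteq> carrier (BijGroup (pverts G))"
    by (auto simp: graph_automorphisms_def BijGroup_def)
  have "(\<lambda>x \<in> pverts G. x) \<in> graph_automorphisms G"
    by (auto simp: graph_automorphisms_def id_Bij)
  then show "graph_automorphisms G \<noteq> {}" by blast
next
  fix f assume f: "f \<in> graph_automorphisms G"
  then have fB: "f \<in> Bij (pverts G)"
    and iff: "\<And>x y. x \<in> pverts G \<Longrightarrow> y \<in> pverts G \<Longrightarrow> (f x, f y) \<in> parcs G \<longleftrightarrow> (x, y) \<in> parcs G"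
    by (auto simp: graph_automorphisms_def)
  let ?g = "inv_into (pverts G) f"
  have img: "f ` pverts G = pverts G" using fB by (auto simp: Bij_def bij_betw_def)
  have "(?g x, ?g y) \<in> parcs G \<longleftrightarrow> (x, y) \<in> parcs G"
    if "x \<in> pverts G" "y \<in> pverts G" for x y
    using iff[of "?g x" "?g y"] that fB img
    by (auto simp: Bij_inv_into_mem f_inv_into_f)
  then show "inv\<^bsub>BijGroup (pverts G)\<^esub> f \<in> graph_automorphisms G"
    using fB restrict_inv_into_Bij[OF fB] by (auto simp: inv_BijGroup graph_automorphisms_def)
next
  fix f g assume "f \<in> graph_automorphisms G" "g \<in> graph_automorphisms G"
  moreover from this have "\<And>x. x \<in> pverts G \<Longrightarrow> g x \<in> pverts G"
    using Bij_imp_funcset by (fastforce simp: graph_automorphisms_def)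
  ultimately show "f \<otimes>\<^bsub>BijGroup (pverts G)\<^esub> g \<in> graph_automorphisms G"
    using compose_Bij[of f "pverts G" g]
    by (auto simp: graph_automorphisms_def BijGroup_def compose_def)
qed

lemma group_automorphism_group: "group (automorphism_group G)"
  unfolding automorphism_group_def
  by (rule subgroup.subgroup_is_group[OF subgroup_graph_automorphisms group_BijGroup])

definition star :: "'a pair_pre_digraph \<Rightarrow> 'a \<Rightarrow> 'a pair_pre_digraph" where
  "star G v = (let N = {w. (v, w) \<in> parcs G} in
     \<lparr>pverts = insert v N, parcs = {v} \<times> N \<union> N \<times> {v}\<rparr>)"

definition leaf :: "'a pair_pre_digraph \<Rightarrow> 'a \<Rightarrow> bool" where
  "leaf T v \<longleftrightarrow> v \<in> pverts T \<and> out_degree T v = 1"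

definition new_neighbours :: "'a pair_pre_digraph \<Rightarrow> 'a pair_pre_digraph \<Rightarrow> 'a \<Rightarrow> 'a set" where
  "new_neighbours G T v = {w. (v, w) \<in> parcs G \<and> w \<notin> pverts T}"

definition grow :: "'a pair_pre_digraph \<Rightarrow> 'a pair_pre_digraph \<Rightarrow> 'a \<Rightarrow> 'a pair_pre_digraph" where
  "grow G T v = (let W = new_neighbours G T v in
     \<lparr>pverts = pverts T \<union> W, parcs = parcs T \<union> {v} \<times> W \<union> W \<times> {v}\<rparr>)"

primrec greedy_tree :: "'a pair_pre_digraph \<Rightarrow> (nat \<Rightarrow> 'a) \<Rightarrow> nat \<Rightarrow> 'a pair_pre_digraph" where
  "greedy_tree G v 0 = star G (v 0)"
| "greedy_tree G v (Suc i) = grow G (greedy_tree G v i) (v (Suc i))"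

text \<open>
  \<open>T = T(v\<^sub>0, \<dots>, v\<^sub>s)\<close>: the sequence is given by the values of \<open>v\<close> on \<open>{0..s}\<close>, other values
  being irrelevant.
\<close>

definition greedy_spanning_tree ::
  "'a pair_pre_digraph \<Rightarrow> (nat \<Rightarrow> 'a) \<Rightarrow> nat \<Rightarrow> 'a pair_pre_digraph \<Rightarrow> bool" where
  "greedy_spanning_tree G v s T \<longleftrightarrow>
     v 0 \<in> pverts G \<and>
     (\<forall>i \<in> {1..s}. leaf (greedy_tree G v (i - 1)) (v i) \<and>
                   new_neighbours G (greedy_tree G v (i - 1)) (v i) \<noteq> {}) \<and>
     T = greedy_tree G v s \<and>
     (\<forall>u. leaf T u \<longrightarrow> new_neighbours G T u = {})"

end

theory Submission
  imports Defs
begin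

text \<open>
  Restrict the automorphisms to \<open>V(T\<^sub>0)\<close>, \<open>V(T\<^sub>1)\<close>, \<open>\<dots>\<close>, \<open>V(T\<^sub>s) = V(G)\<close> in turn. The
  restriction of \<open>f\<close> to \<open>X = V(T\<^sub>i\<^sub>-\<^sub>1)\<close> determines the image of the set \<open>W\<close> of vertices added at
  \<open>v\<^sub>i\<close>, namely the neighbours of \<open>f v\<^sub>i\<close> outside \<open>f ` X\<close>. So each restriction to \<open>X\<close> extends in at
  most \<open>|W|!\<close> ways to \<open>X \<union> W\<close>, and \<open>|W| = d\<^sub>T(v\<^sub>i) - 1\<close> since \<open>v\<^sub>i\<close> is a leaf when it is chosen
  and gets no further edges afterwards. On \<open>{v\<^sub>0}\<close> there are as many restrictions as points in
  the orbit of \<open>v\<^sub>0\<close>.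
\<close>

section \<open>Counting restrictions of a finite family of functions\<close>

lemma card_le_card_image_mult:
  assumes "finite A" and "\<And>a. a \<in> A \<Longrightarrow> card {x \<in> A. g x = g a} \<le> k"
  shows "card A \<le> card (g ` A) * k"
proof -
  have "A = (\<Union>b\<in>g ` A. {x \<in> A. g x = b})" by auto
  then have "card A \<le> (\<Sum>b\<in>g ` A. card {x \<in> A. g x = b})"
    using card_UN_le[of "g ` A" "\<lambda>b. {x \<in> A. g x = b}"] assms(1) by simp
  also have "\<dots> \<le> of_nat (card (g ` A)) * k"
    using assms(2) by (intro sum_bounded_above) auto
  finally show ?thesis by simp
qed

lemma card_injective_funcset:
  assumes "finite W" and "finite U" and "card U = card W"
  shows "card {p \<in> W \<rightarrow>\<^sub>E U. inj_on p W} = fact (card W)"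
  using card_inj_on_subset_funcset[OF assms(1,2) order_refl] assms(3)
  by (simp add: fact_prod_rev)

text \<open>By the assumption \<open>image\<close>, all members of \<open>F\<close> with the same
  restriction to \<open>X\<close> map \<open>W\<close> onto one common set. On \<open>W\<close> they
  are therefore bijections between two fixed sets of equal size, which bounds each fibre of the map
  restricting further to \<open>X\<close>.\<close>

lemma card_restrict_Un_le:
  fixes F :: "('a \<Rightarrow> 'b) set"
  assumes F: "finite F" and W: "finite W"
    and inj: "\<And>f. f \<in> F \<Longrightarrow> inj_on f W"
    and image: "\<And>f h. f \<in> F \<Longrightarrow> h \<in> F \<Longrightarrow> restrict f X = restrict h X \<Longrightarrow> f ` W = h ` W"
  shows "card ((\<lambda>f. restrict f (X \<union> W)) ` F) \<le> card ((\<lambda>f. restrict f X) ` F) * fact (card W)"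
proof -
  let ?A = "(\<lambda>f. restrict f (X \<union> W)) ` F" and ?g = "\<lambda>r. restrict r X"
  have "card {r \<in> ?A. ?g r = ?g a} \<le> fact (card W)" if "a \<in> ?A" for a
  proof -
    from that obtain h where h: "h \<in> F" "a = restrict h (X \<union> W)" by auto
    let ?P = "{p \<in> W \<rightarrow>\<^sub>E h ` W. inj_on p W}"
    have into: "(\<lambda>r. restrict r W) ` {r \<in> ?A. ?g r = ?g a} \<subseteq> ?P"
    proof clarify
      fix f assume f: "f \<in> F" "?g (restrict f (X \<union> W)) = ?g a"
      then have "restrict f X = restrict h X" by (simp add: h(2) Int_absorb2 Int_absorb1)
      then have "f ` W = h ` W" using image f h by blast
      then show "restrict (restrict f (X \<union> W)) W \<in> W \<rightarrow>\<^sub>E h ` W \<and>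
          inj_on (restrict (restrict f (X \<union> W)) W) W"
        using inj[OF f(1)] by (auto simp: inj_on_def)
    qed
    \<comment> \<open>Members of one fibre share their values on \<open>X\<close>, and outside
      \<open>X \<union> W\<close> all of them are \<open>undefined\<close>, so the values on
      \<open>W\<close> determine the function.\<close>
    have "inj_on (\<lambda>r. restrict r W) {r \<in> ?A. ?g r = ?g a}"
    proof (rule inj_onI)
      fix r r' assume r: "r \<in> {r \<in> ?A. ?g r = ?g a}" and r': "r' \<in> {r \<in> ?A. ?g r = ?g a}"
        and W: "restrict r W = restrict r' W"
      from r r' have X: "restrict r X = restrict r' X" by simp
      show "r = r'"
      proof (rule extensionalityI)
        show "r \<in> extensional (X \<union> W)" "r' \<in> extensional (X \<union> W)" using r r' by auto
        fix x assume "x \<in> X \<union> W"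
        then show "r x = r' x" using fun_cong[OF W, of x] fun_cong[OF X, of x] by auto
      qed
    qed
    moreover have "finite ?P"
      using W by (intro finite_subset[of ?P "W \<rightarrow>\<^sub>E h ` W"] finite_PiE) auto
    ultimately have "card {r \<in> ?A. ?g r = ?g a} \<le> card ?P"
      using into by (intro card_inj_on_le)
    also have "\<dots> = fact (card W)"
      using inj[OF h(1)] W by (intro card_injective_funcset) (auto simp: card_image)
    finally show ?thesis .
  qed
  then have "card ?A \<le> card (?g ` ?A) * fact (card W)"
    using F by (intro card_le_card_image_mult) auto
  also have "?g ` ?A = (\<lambda>f. restrict f X) ` F"
    by (simp add: image_image Int_absorb1 Int_absorb2)
  finally show ?thesis .
qed

section \<open>Automorphisms and their restrictions to vertex sets\<close>

lemma finite_graph_automorphisms: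
  assumes "finite (pverts G)"
  shows "finite (graph_automorphisms G)"
proof (rule finite_subset)
  show "graph_automorphisms G \<subseteq> pverts G \<rightarrow>\<^sub>E pverts G"
    by (auto simp: graph_automorphisms_def Bij_def bij_betw_def PiE_def)
  show "finite (pverts G \<rightarrow>\<^sub>E pverts G)" using assms by (simp add: finite_PiE)
qed

lemma carrier_automorphism_group [simp]:
  "carrier (automorphism_group G) = graph_automorphisms G"
  by (simp add: automorphism_group_def)

lemma orbit_automorphism_group:
  "orbit (automorphism_group G) (\<lambda>f. f) x = (\<lambda>f. f x) ` graph_automorphisms G"
  by (auto simp: orbit_def)

text \<open>For the automorphisms this is the length of the orbit of \<open>x\<close>, the starting
  value of the induction over the trees.\<close>

lemma card_restrict_singleton:
  "card ((\<lambda>f. restrict f {x}) ` F) = card ((\<lambda>f. f x) ` F)"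
proof -
  have "(\<lambda>r. r x) ` (\<lambda>f. restrict f {x}) ` F = (\<lambda>f. f x) ` F" by (simp add: image_image)
  moreover have "inj_on (\<lambda>r. r x) ((\<lambda>f. restrict f {x}) ` F)"
    by (auto simp: inj_on_def restrict_def)
  ultimately show ?thesis using card_image by metis
qed

text \<open>An automorphism is injective on vertices and both preserves and reflects adjacency. The
  right-hand side involves \<open>f\<close> only through its values on \<open>X\<close>, which is
  what the assumption \<open>image\<close> of \<open>card_restrict_Un_le\<close> demands.\<close>

lemma (in pair_graph) automorphism_image_new_neighbours:
  assumes f: "f \<in> graph_automorphisms G" and X: "X \<subseteq> pverts G" and x: "x \<in> X"
  shows "f ` {w. (x, w) \<in> parcs G \<and> w \<notin> X} = {y. (f x, y) \<in> parcs G \<and> y \<notin> f ` X}"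
proof -
  have bij: "bij_betw f (pverts G) (pverts G)"
    and arc: "\<And>a b. a \<in> pverts G \<Longrightarrow> b \<in> pverts G \<Longrightarrow> (f a, f b) \<in> parcs G \<longleftrightarrow> (a, b) \<in> parcs G"
    using f by (auto simp: graph_automorphisms_def Bij_def)
  have inj: "\<And>a b. a \<in> pverts G \<Longrightarrow> b \<in> pverts G \<Longrightarrow> f a = f b \<Longrightarrow> a = b"
    using bij by (auto simp: bij_betw_def inj_on_def)
  have vert: "(a, b) \<in> parcs G \<Longrightarrow> b \<in> pverts G" for a b
    using arc_snd_in_verts[of "(a, b)"] by simp
  show ?thesis
  proof (intro equalityI subsetI)
    fix y assume "y \<in> f ` {w. (x, w) \<in> parcs G \<and> w \<notin> X}"
    then obtain w where w: "y = f w" "(x, w) \<in> parcs G" "w \<notin> X" by auto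
    then have "(f x, f w) \<in> parcs G" using arc vert X x by blast
    moreover have "f w \<notin> f ` X" using inj vert w X by blast
    ultimately show "y \<in> {y. (f x, y) \<in> parcs G \<and> y \<notin> f ` X}" using w by simp
  next
    fix y assume y: "y \<in> {y. (f x, y) \<in> parcs G \<and> y \<notin> f ` X}"
    then have "y \<in> f ` pverts G" using vert bij by (auto simp: bij_betw_def)
    then obtain w where w: "w \<in> pverts G" "y = f w" by blast
    then have "(x, w) \<in> parcs G" using y arc X x by blast
    then show "y \<in> f ` {w. (x, w) \<in> parcs G \<and> w \<notin> X}" using y w by blast
  qed
qed

text \<open>With \<open>X\<close> arbitrary, the bound covers the initial star, seen as growth from
  \<open>{v 0}\<close>, as well as every later step.\<close>

lemma (in pair_graph) card_restrict_automorphisms_step: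
  fixes X :: "'a set" and x :: 'a
  defines "W \<equiv> {w. (x, w) \<in> parcs G \<and> w \<notin> X}"
  assumes X: "X \<subseteq> pverts G" and x: "x \<in> X"
  shows "card ((\<lambda>f. restrict f (X \<union> W)) ` graph_automorphisms G)
    \<le> card ((\<lambda>f. restrict f X) ` graph_automorphisms G) * fact (card W)"
proof (rule card_restrict_Un_le)
  have WG: "W \<subseteq> pverts G" using arc_snd_in_verts by (fastforce simp: W_def)
  then show "finite W" using pair_finite_verts finite_subset by blast
  show "finite (graph_automorphisms G)" by (intro finite_graph_automorphisms pair_finite_verts)
  show "inj_on f W" if "f \<in> graph_automorphisms G" for f
    using that WG by (auto simp: graph_automorphisms_def Bij_def bij_betw_def intro: inj_on_subset)
  fix f h assume fh: "f \<in> graph_automorphisms G" "h \<in> graph_automorphisms G"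
    and "restrict f X = restrict h X"
  then have eq: "\<And>a. a \<in> X \<Longrightarrow> f a = h a" by (metis restrict_apply')
  have "f x = h x" "f ` X = h ` X" using eq x by auto
  then show "f ` W = h ` W"
    unfolding W_def using fh X x by (simp add: automorphism_image_new_neighbours)
qed

section \<open>Connectedness and the shape of partial trees\<close>

lemma (in pair_graph) connected_closed_eq_pverts:
  assumes "connected G" and "x \<in> S" and "S \<subseteq> pverts G"
    and closed: "\<And>a b. a \<in> S \<Longrightarrow> (a, b) \<in> parcs G \<Longrightarrow> b \<in> S"
  shows "S = pverts G"
proof
  have sc: "strongly_connected G"
    using assms(1) pair_sym_arcs by (intro symmetric_connected_imp_strongly_connected)
  show "pverts G \<subseteq> S"
  proof
    fix y assume "y \<in> pverts G"
    then have "x \<rightarrow>\<^sup>*\<^bsub>G\<^esub> y" using sc assms(2,3) by (auto simp: strongly_connected_def)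
    then show "y \<in> S"
      by (induct rule: reachable_induct) (use closed assms(2) in \<open>auto simp: arcs_ends_conv\<close>)
  qed
qed fact

lemma out_degree_with_proj:
  "out_degree (with_proj T) u = card {w. (u, w) \<in> parcs T}"
proof -
  have "out_arcs (with_proj T) u = Pair u ` {w. (u, w) \<in> parcs T}" by auto
  then show ?thesis by (simp add: out_degree_def card_image inj_on_def)
qed

text \<open>The invariant of the construction. Its last conjunct ensures that once no leaf can grow,
  no vertex at all has a neighbour outside \<open>T\<close>. The middle one ensures that a vertex
  outside \<open>T\<close> carries no arc yet, and so becomes a leaf when it is attached.\<close>

definition partial_greedy_tree :: "'a pair_pre_digraph \<Rightarrow> 'a pair_pre_digraph \<Rightarrow> bool" where
  "partial_greedy_tree G T \<longleftrightarrow> pverts T \<subseteq> pverts G \<and> parcs T \<subseteq> pverts T \<times> pverts T \<and>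
     (\<forall>u \<in> pverts T. out_degree T u = 1 \<or> new_neighbours G T u = {})"

lemma (in pair_graph) partial_greedy_tree_star:
  assumes "x \<in> pverts G"
  shows "partial_greedy_tree G (star G x)"
proof -
  have vert: "(x, w) \<in> parcs G \<Longrightarrow> w \<in> pverts G" for w
    using arc_snd_in_verts[of "(x, w)"] by simp
  have loop: "(x, x) \<notin> parcs G" using pair_no_loops[of "(x, x)"] by auto
  have "{w. (u, w) \<in> parcs (star G x)} = {x}" if "(x, u) \<in> parcs G" for u
    using that loop by (auto simp: star_def Let_def)
  then have "out_degree (star G x) u = 1" if "(x, u) \<in> parcs G" for u
    using that by (simp add: out_degree_with_proj)
  \<comment> \<open>The centre may have any degree, even 0, so it satisfies the invariant through
    the second alternative.\<close>
  moreover have "new_neighbours G (star G x) x = {}"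
    by (auto simp: new_neighbours_def star_def Let_def)
  ultimately show ?thesis
    using assms vert by (auto simp: partial_greedy_tree_def star_def Let_def)
qed

lemma out_degree_grow_other:
  assumes "u \<in> pverts T" and "u \<noteq> x"
  shows "out_degree (grow G T x) u = out_degree T u"
proof -
  have "{w. (u, w) \<in> parcs (grow G T x)} = {w. (u, w) \<in> parcs T}"
    using assms by (auto simp: grow_def Let_def new_neighbours_def)
  then show ?thesis by (simp add: out_degree_with_proj)
qed

lemma out_degree_grow_self:
  assumes "parcs T \<subseteq> pverts T \<times> pverts T" and "finite (pverts T)"
    and "x \<in> pverts T" and "finite (new_neighbours G T x)"
  shows "out_degree (grow G T x) x = out_degree T x + card (new_neighbours G T x)"
proof -
  have "{w. (x, w) \<in> parcs (grow G T x)} = {w. (x, w) \<in> parcs T} \<union> new_neighbours G T x"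
    using assms(3) by (auto simp: grow_def Let_def new_neighbours_def)
  moreover have "{w. (x, w) \<in> parcs T} \<subseteq> pverts T" using assms(1) by auto
  then have "finite {w. (x, w) \<in> parcs T}"
    and "{w. (x, w) \<in> parcs T} \<inter> new_neighbours G T x = {}"
    using assms(2) by (auto simp: new_neighbours_def intro: finite_subset)
  ultimately show ?thesis using assms(4) by (simp add: out_degree_with_proj card_Un_disjoint)
qed

lemma (in pair_graph) partial_greedy_tree_grow:
  assumes T: "partial_greedy_tree G T" and x: "x \<in> pverts T"
  shows "partial_greedy_tree G (grow G T x)"
proof -
  let ?W = "new_neighbours G T x"
  have vert: "(a, b) \<in> parcs G \<Longrightarrow> b \<in> pverts G" for a b
    using arc_snd_in_verts[of "(a, b)"] by simp
  have verts: "pverts (grow G T x) = pverts T \<union> ?W" by (simp add: grow_def Let_def)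
  have TT: "parcs T \<subseteq> pverts T \<times> pverts T" using T by (simp add: partial_greedy_tree_def)
  have "out_degree (grow G T x) u = 1 \<or> new_neighbours G (grow G T x) u = {}"
    if u: "u \<in> pverts (grow G T x)" for u
  proof -
    \<comment> \<open>The grown vertex \<open>x\<close> has used up its new neighbours, the other
      old vertices keep their degree and gain no new neighbours, and the added vertices are joined
      to \<open>x\<close> alone.\<close>
    consider "u = x" | "u \<in> pverts T" "u \<noteq> x" | "u \<in> ?W" using u verts by auto
    then show ?thesis
    proof cases
      case 1
      then show ?thesis by (auto simp: new_neighbours_def grow_def Let_def)
    next
      case 2
      then show ?thesis
        using T by (auto simp: out_degree_grow_other partial_greedy_tree_def new_neighbours_def
            verts simp del: One_nat_def)
    next
      case 3
      then have "{w. (u, w) \<in> parcs (grow G T x)} = {x}"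
        using TT x by (auto simp: grow_def Let_def new_neighbours_def)
      then show ?thesis by (simp add: out_degree_with_proj)
    qed
  qed
  then show ?thesis
    using T x vert by (auto simp: partial_greedy_tree_def grow_def Let_def new_neighbours_def)
qed

section \<open>Degrees, layers and the counting induction along a greedy sequence\<close>

context pair_graph
begin

context
  fixes v :: "nat \<Rightarrow> 'a" and s :: nat and T :: "'a pair_pre_digraph"
  assumes greedy: "greedy_spanning_tree G v s T"
begin

text \<open>Meant for \<open>i \<ge> 1\<close>: at \<open>i = 0\<close> the truncated
  \<open>i - 1\<close> would pair \<open>v 0\<close> with its own star.\<close>

abbreviation new_layer :: "nat \<Rightarrow> 'a set" where
  "new_layer i \<equiv> new_neighbours G (greedy_tree G v (i - 1)) (v i)"

lemma greedy_step:
  assumes "1 \<le> i" "i \<le> s"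
  shows "v i \<in> pverts (greedy_tree G v (i - 1))"
    and "out_degree (greedy_tree G v (i - 1)) (v i) = 1"
    and "new_layer i \<noteq> {}"
  using greedy assms by (auto simp: greedy_spanning_tree_def leaf_def)

lemma partial_greedy_tree_greedy:
  "i \<le> s \<Longrightarrow> partial_greedy_tree G (greedy_tree G v i)"
proof (induction i)
  case 0
  then show ?case using greedy by (simp add: greedy_spanning_tree_def partial_greedy_tree_star)
next
  case (Suc i)
  then show ?case using greedy_step(1)[of "Suc i"] by (simp add: partial_greedy_tree_grow)
qed

lemma finite_new_neighbours: "finite (new_neighbours G H x)"
  by (rule finite_subset[OF _ pair_finite_verts])
    (use arc_snd_in_verts in \<open>fastforce simp: new_neighbours_def\<close>)

lemma greedy_tree_degree:
  assumes "1 \<le> i" "i \<le> j" "j \<le> s"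
  shows "v i \<in> pverts (greedy_tree G v j) \<and>
    out_degree (greedy_tree G v j) (v i) = 1 + card (new_layer i)"
  using assms(2,3)
proof (induction rule: dec_induct)
  case base
  obtain k where k: "i = Suc k" using assms(1) by (cases i) auto
  have "partial_greedy_tree G (greedy_tree G v k)"
    using partial_greedy_tree_greedy assms k by simp
  then have "parcs (greedy_tree G v k) \<subseteq> pverts (greedy_tree G v k) \<times> pverts (greedy_tree G v k)"
    and "finite (pverts (greedy_tree G v k))"
    using pair_finite_verts by (auto simp: partial_greedy_tree_def intro: finite_subset)
  then show ?case
    using greedy_step[of i] assms k
    by (simp add: out_degree_grow_self finite_new_neighbours) (simp add: grow_def Let_def)
next
  case (step j)
  \<comment> \<open>By induction \<open>v i\<close> has degree at least 2 in the tree with index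
    \<open>j\<close>, because its layer is nonempty, whereas \<open>v (Suc j)\<close> is a leaf
    there. Hence this step leaves the degree of \<open>v i\<close> alone.\<close>
  have "v i \<noteq> v (Suc j)"
    using step greedy_step[of "Suc j"] greedy_step(3)[of i] assms finite_new_neighbours by auto
  then show ?case
    using step by (simp add: out_degree_grow_other) (simp add: grow_def Let_def)
qed

text \<open>Once grown, a vertex has degree at least 2 in all later trees and cannot be the leaf
  chosen next.\<close>

lemma greedy_vertices_inj: "inj_on v {1..s}"
proof (rule linorder_inj_onI)
  fix i j assume ij: "i < j" "i \<in> {1..s}" "j \<in> {1..s}"
  then show "v i \<noteq> v j"
    using greedy_tree_degree[of i "j - 1"] greedy_step(2)[of j] greedy_step(3)[of i]
      finite_new_neighbours by auto
qed auto

lemma out_degree_greedy_tree: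
  assumes "i \<in> {1..s}"
  shows "out_degree T (v i) - 1 = card (new_layer i)"
  using greedy_tree_degree[of i s] greedy assms by (simp add: greedy_spanning_tree_def)

text \<open>Layer sizes do not depend on \<open>j\<close>, so each step of the induction only
  appends a factor. Degrees in \<open>T\<close> replace them afterwards, through
  \<open>out_degree_greedy_tree\<close>.\<close>

lemma card_restrict_automorphisms_greedy_tree:
  "j \<le> s \<Longrightarrow> card ((\<lambda>f. restrict f (pverts (greedy_tree G v j))) ` graph_automorphisms G)
    \<le> card ((\<lambda>f. f (v 0)) ` graph_automorphisms G) * fact (out_degree G (v 0)) *
        (\<Prod>i = 1..j. fact (card (new_layer i)))"
proof (induction j)
  case 0
  \<comment> \<open>Without a loop at \<open>v 0\<close>, all its neighbours lie outside
    \<open>{v 0}\<close>, so the first step contributes the factorial of the full degree.\<close>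
  have "(v 0, v 0) \<notin> parcs G" using pair_no_loops[of "(v 0, v 0)"] by auto
  then have "{w. (v 0, w) \<in> parcs G \<and> w \<notin> {v 0}} = {w. (v 0, w) \<in> parcs G}" by auto
  moreover have "pverts (greedy_tree G v 0) = {v 0} \<union> {w. (v 0, w) \<in> parcs G}"
    by (auto simp: star_def Let_def)
  moreover have "v 0 \<in> pverts G" using greedy by (simp add: greedy_spanning_tree_def)
  ultimately show ?case
    using card_restrict_automorphisms_step[of "{v 0}" "v 0"]
    by (simp add: card_restrict_singleton out_degree_with_proj del: greedy_tree.simps restrict_apply)
next
  case (Suc j)
  let ?V = "pverts (greedy_tree G v j)" and ?R = "\<lambda>X. (\<lambda>f. restrict f X) ` graph_automorphisms G"
  have "?V \<subseteq> pverts G" using partial_greedy_tree_greedy[of j] Suc.prems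
    by (simp add: partial_greedy_tree_def)
  then have "card (?R (?V \<union> new_layer (Suc j))) \<le> card (?R ?V) * fact (card (new_layer (Suc j)))"
    using card_restrict_automorphisms_step[of ?V "v (Suc j)"] greedy_step(1)[of "Suc j"] Suc.prems
    by (simp add: new_neighbours_def)
  also have "\<dots> \<le> card ((\<lambda>f. f (v 0)) ` graph_automorphisms G) * fact (out_degree G (v 0)) *
        (\<Prod>i = 1..j. fact (card (new_layer i))) * fact (card (new_layer (Suc j)))"
    using Suc.prems by (intro mult_right_mono[OF Suc.IH]) auto
  finally show ?case by (simp add: grow_def Let_def mult.assoc del: restrict_apply)
qed

text \<open>The vertex set of \<open>T\<close> is closed under adjacency in \<open>G\<close>: leaves
  have no new neighbours by the stopping rule, all other vertices by the invariant.\<close>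

lemma pverts_greedy_spanning_tree:
  assumes "connected G"
  shows "pverts T = pverts G"
proof -
  have T: "T = greedy_tree G v s" and stop: "\<And>u. leaf T u \<Longrightarrow> new_neighbours G T u = {}"
    using greedy by (auto simp: greedy_spanning_tree_def)
  have part: "partial_greedy_tree G T" using partial_greedy_tree_greedy T by simp
  have "v 0 \<in> pverts (greedy_tree G v j)" for j
    by (induction j) (auto simp: star_def grow_def Let_def)
  moreover have "b \<in> pverts T" if "a \<in> pverts T" "(a, b) \<in> parcs G" for a b
  proof -
    have "new_neighbours G T a = {}"
      using that(1) part stop by (auto simp: partial_greedy_tree_def leaf_def)
    then show ?thesis using that(2) by (auto simp: new_neighbours_def)
  qed
  ultimately show ?thesis
    using assms part T by (intro connected_closed_eq_pverts) (auto simp: partial_greedy_tree_def)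
qed

lemma order_automorphism_group_le:
  assumes "connected G"
  shows "order (automorphism_group G)
    \<le> card (orbit (automorphism_group G) (\<lambda>f. f) (v 0)) * fact (out_degree G (v 0)) *
        (\<Prod>i = 1..s. fact (out_degree T (v i) - 1))"
proof -
  \<comment> \<open>Automorphisms are extensional, hence unchanged by restriction to all vertices.
    So the count for the last tree is the order of the group.\<close>
  have "(\<lambda>f. restrict f (pverts G)) ` graph_automorphisms G = id ` graph_automorphisms G"
    by (intro image_cong)
      (auto simp: graph_automorphisms_def Bij_def intro: extensional_restrict)
  moreover have "pverts (greedy_tree G v s) = pverts G"
    using pverts_greedy_spanning_tree[OF assms] greedy by (simp add: greedy_spanning_tree_def)
  moreover have "(\<Prod>i = 1..s. fact (out_degree T (v i) - 1)) =
      (\<Prod>i = 1..s. fact (card (new_layer i)) :: nat)"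
    by (intro prod.cong refl) (simp only: out_degree_greedy_tree)
  ultimately show ?thesis
    using card_restrict_automorphisms_greedy_tree[of s]
    by (simp add: order_def orbit_automorphism_group)
qed

end

lemma card_orbit_automorphism_group_le:
  assumes "x \<in> pverts G"
  shows "card (orbit (automorphism_group G) (\<lambda>f. f) x) \<le> card (pverts G)"
  using assms pair_finite_verts unfolding orbit_automorphism_group
  by (intro card_mono) (auto simp: graph_automorphisms_def Bij_def bij_betw_def)

end

theorem theorem3:
  fixes G T :: "'a pair_pre_digraph" and v :: "nat \<Rightarrow> 'a" and s n n\<^sub>1 :: nat
  assumes "pair_graph G"
    and "connected G"
    and "n = card (pverts G)"
    and "greedy_spanning_tree G v s T"
    and "n\<^sub>1 = card (orbit (automorphism_group G) (\<lambda>f. f) (v 0))"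
  shows "order (automorphism_group G)
           \<le> n\<^sub>1 * fact (out_degree G (v 0)) * (\<Prod>i = 1..s. fact (out_degree T (v i) - 1))
         \<and> order (automorphism_group G)
           \<le> n * fact (out_degree G (v 0)) * (\<Prod>u \<in> pverts G. fact (out_degree T u - 1))"
proof -
  interpret pair_graph G by fact
  note greedy = assms(4)
  have v0: "v 0 \<in> pverts G" using greedy by (simp add: greedy_spanning_tree_def)
  have bound: "order (automorphism_group G)
      \<le> n\<^sub>1 * fact (out_degree G (v 0)) * (\<Prod>i = 1..s. fact (out_degree T (v i) - 1))"
    using order_automorphism_group_le[OF greedy assms(2)] assms(5) by simp
  have sub: "v ` {1..s} \<subseteq> pverts G"
    using greedy_tree_degree[OF greedy, of _ s] greedy pverts_greedy_spanning_tree[OF greedy assms(2)]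
    by (auto simp: greedy_spanning_tree_def)
  have "(\<Prod>i = 1..s. fact (out_degree T (v i) - 1)) =
      (\<Prod>u \<in> v ` {1..s}. fact (out_degree T u - 1) :: nat)"
    using greedy_vertices_inj[OF greedy] by (simp add: prod.reindex)
  \<comment> \<open>The smaller product divides the larger, positive one. A vertex of degree 0, as
    in the one-vertex graph, contributes \<open>fact 0\<close> by truncated subtraction.\<close>
  also have "\<dots> \<le> (\<Prod>u \<in> pverts G. fact (out_degree T u - 1))"
    using sub pair_finite_verts by (intro dvd_imp_le prod_dvd_prod_subset prod_pos) auto
  finally have "n\<^sub>1 * fact (out_degree G (v 0)) * (\<Prod>i = 1..s. fact (out_degree T (v i) - 1))
      \<le> n * fact (out_degree G (v 0)) * (\<Prod>u \<in> pverts G. fact (out_degree T u - 1))"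
    using card_orbit_automorphism_group_le[OF v0] assms(3,5) by (intro mult_mono) auto
  with bound show ?thesis using order_trans by blast
qed

end
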